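(* Let $\omega$ be a non-degenerate skew-symmetric bilinear form on $\mathbb{R}^{2n}$, and let $\nabla,\nabla'$ be two affine structures on $\mathbb{R}^{2n}$, both compatible with $\omega$, satisfying $\nabla_x\nabla'_y=\nabla_y\nabla'_x$ for all $x,y\in\mathbb{R}^{2n}$. Let $N_{\nabla,\nabla'}$ be the associated nilpotent Lie group, $\mathfrak{n}_{\nabla,\nabla'}$ its Lie algebra, and $g$ the left-invariant hypersymplectic metric on $N_{\nabla,\nabla'}$ determined on $\mathfrak{n}_{\nabla,\nabla'}=\mathbb{R}^{2n}\oplus\mathbb{R}^{2n}$ by $g((x,x'),(y,y'))=-\omega(x,y')+\omega(x',y)$. The following conditions are equivalent: (i) the Lie algebra $\mathfrak{n}_{\nabla,\nabla'}$ is at most $2$-step nilpotent; (ii) $\nabla_x\nabla'_y=0$ for all $x,y\in\mathbb{R}^{2n}$; (iii) the hypersymplectic metric $g$ is flat.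
   Context: An affine structure on $\mathbb{R}^m$ is a bilinear map $\nabla:\mathbb{R}^m\times\mathbb{R}^m\to\mathbb{R}^m$, $(x,y)\mapsto\nabla_xy$, such that $\nabla_xy=\nabla_yx$ and $\nabla_x\nabla_y=\nabla_y\nabla_x$ (as endomorphisms of $\mathbb{R}^m$) for all $x,y\in\mathbb{R}^m$. It is compatible with a non-degenerate skew-symmetric bilinear form $\omega$ on $\mathbb{R}^m$ if $\omega(\nabla_xy,z)=\omega(\nabla_xz,y)$ for all $x,y,z\in\mathbb{R}^m$. Given $\omega,\nabla,\nabla'$ as in the claim, $N_{\nabla,\nabla'}$ is the manifold $\mathbb{R}^{4n}=\mathbb{R}^{2n}\times\mathbb{R}^{2n}$ with the product $$(x,x')\cdot(y,y')=\bigl(x+y+\nabla'_yx'-\tfrac12\nabla'_y\nabla_yx',\ x'-\nabla_{x'}y-\tfrac12\nabla_{x'}\nabla'_{x'}y+y'\bigr).$$ It is a nilpotent Lie group with neutral element $(0,0)$, and its Lie algebra $\mathfrak{n}_{\nabla,\nabla'}$ is $\mathbb{R}^{2n}\oplus\mathbb{R}^{2n}$ with bracket $[(x,x'),(y,y')]=(\nabla'_yx'-\nabla'_xy',\ \nabla_xy'-\nabla_yx')$. The metric $g$ is pseudo-Riemannian of signature $(2n,2n)$; together with the left-invariant endomorphisms $J(x,x')=(-x',x)$ and $E(x,x')=(x,-x')$ it forms a hypersymplectic structure on $N_{\nabla,\nabla'}$, whence its name. Flat means that the curvature tensor of the Levi-Civita connection of $g$ vanishes. A Lie algebra $\mathfrak{n}$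 is at most $2$-step nilpotent if $[\mathfrak{n},[\mathfrak{n},\mathfrak{n}]]=0$. *)

theory Defs
  imports "HOL-Analysis.Analysis"
begin

primrec times_cont_differentiable ::
    "nat \<Rightarrow> ('a::euclidean_space \<Rightarrow> 'b::real_normed_vector) \<Rightarrow> bool" where
  "times_cont_differentiable 0 f \<longleftrightarrow> continuous_on UNIV f"
| "times_cont_differentiable (Suc k) f \<longleftrightarrow>
     (\<forall>x. f differentiable (at x)) \<and>
     (\<forall>v. times_cont_differentiable k (\<lambda>x. frechet_derivative f (at x) v))"

definition smooth :: "('a::euclidean_space \<Rightarrow> 'b::real_normed_vector) \<Rightarrow> bool" where
  "smooth f \<longleftrightarrow> (\<forall>k. times_cont_differentiable k f)"

text \<open>Euclidean space is a manifold with a single chart, so a vector field on it is a map from the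
  space to itself.\<close>

definition deriv_along ::
    "('a::euclidean_space \<Rightarrow> 'a) \<Rightarrow> ('a \<Rightarrow> 'b::real_normed_vector) \<Rightarrow> 'a \<Rightarrow> 'b" where
  "deriv_along X f = (\<lambda>p. frechet_derivative f (at p) (X p))"

definition field_bracket ::
    "('a::euclidean_space \<Rightarrow> 'a) \<Rightarrow> ('a \<Rightarrow> 'a) \<Rightarrow> 'a \<Rightarrow> 'a" where
  "field_bracket X Y = (\<lambda>p. deriv_along X Y p - deriv_along Y X p)"

text \<open>A connection is an operator on vector fields; only its values on smooth fields matter.\<close>

type_synonym 'a connection = "('a \<Rightarrow> 'a) \<Rightarrow> ('a \<Rightarrow> 'a) \<Rightarrow> 'a \<Rightarrow> 'a"

definition affine_connection :: "('a::euclidean_space) connection \<Rightarrow> bool" where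
  "affine_connection D \<longleftrightarrow>
     (\<forall>X Y. smooth X \<longrightarrow> smooth Y \<longrightarrow> smooth (D X Y)) \<and>
     (\<forall>X X' Y. smooth X \<longrightarrow> smooth X' \<longrightarrow> smooth Y \<longrightarrow>
        D (\<lambda>p. X p + X' p) Y = (\<lambda>p. D X Y p + D X' Y p)) \<and>
     (\<forall>f X Y. smooth (f :: 'a \<Rightarrow> real) \<longrightarrow> smooth X \<longrightarrow> smooth Y \<longrightarrow>
        D (\<lambda>p. f p *\<^sub>R X p) Y = (\<lambda>p. f p *\<^sub>R D X Y p)) \<and>
     (\<forall>X Y Y'. smooth X \<longrightarrow> smooth Y \<longrightarrow> smooth Y' \<longrightarrow>
        D X (\<lambda>p. Y p + Y' p) = (\<lambda>p. D X Y p + D X Y' p)) \<and>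
     (\<forall>f X Y. smooth (f :: 'a \<Rightarrow> real) \<longrightarrow> smooth X \<longrightarrow> smooth Y \<longrightarrow>
        D X (\<lambda>p. f p *\<^sub>R Y p) = (\<lambda>p. deriv_along X f p *\<^sub>R Y p + f p *\<^sub>R D X Y p))"

text \<open>A metric \<open>g\<close> assigns to each point \<open>p\<close> the bilinear form \<open>g p\<close> on the tangent space at \<open>p\<close>.\<close>

definition levi_civita ::
    "('a::euclidean_space \<Rightarrow> 'a \<Rightarrow> 'a \<Rightarrow> real) \<Rightarrow> 'a connection \<Rightarrow> bool" where
  "levi_civita g D \<longleftrightarrow>
     affine_connection D \<and>
     (\<forall>X Y. smooth X \<longrightarrow> smooth Y \<longrightarrow>
        (\<forall>p. D X Y p - D Y X p = field_bracket X Y p)) \<and>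
     (\<forall>X Y Z. smooth X \<longrightarrow> smooth Y \<longrightarrow> smooth Z \<longrightarrow>
        (\<forall>p. deriv_along X (\<lambda>q. g q (Y q) (Z q)) p = g p (D X Y p) (Z p) + g p (Y p) (D X Z p)))"

definition curvature ::
    "('a::euclidean_space) connection \<Rightarrow> ('a \<Rightarrow> 'a) \<Rightarrow> ('a \<Rightarrow> 'a) \<Rightarrow> ('a \<Rightarrow> 'a) \<Rightarrow> 'a \<Rightarrow> 'a" where
  "curvature D X Y Z = (\<lambda>p. D X (D Y Z) p - D Y (D X Z) p - D (field_bracket X Y) Z p)"

text \<open>The Levi-Civita connection of a pseudo-Riemannian metric exists and is unique on smooth
  fields, so the existential quantifier refers to that connection.\<close>

definition flat_metric :: "('a::euclidean_space \<Rightarrow> 'a \<Rightarrow> 'a \<Rightarrow> real) \<Rightarrow> bool" where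
  "flat_metric g \<longleftrightarrow>
     (\<exists>D. levi_civita g D \<and>
        (\<forall>X Y Z. smooth X \<longrightarrow> smooth Y \<longrightarrow> smooth Z \<longrightarrow> (\<forall>p. curvature D X Y Z p = 0)))"

text \<open>For a Lie group structure \<open>mul\<close> on a Euclidean space with neutral element \<open>e\<close>, the differential
  at \<open>e\<close> of the left translation \<open>mul p\<close> is an isomorphism onto the tangent space at \<open>p\<close>. A
  left-invariant metric is obtained from its value \<open>b\<close> at \<open>e\<close> by transport along these
  isomorphisms.\<close>

definition left_invariant_metric ::
    "('a::euclidean_space \<Rightarrow> 'a \<Rightarrow> 'a) \<Rightarrow> 'a \<Rightarrow> ('a \<Rightarrow> 'a \<Rightarrow> real) \<Rightarrow> 'a \<Rightarrow> 'a \<Rightarrow> 'a \<Rightarrow> real" where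
  "left_invariant_metric mul e b p u v =
     b (inv (frechet_derivative (mul p) (at e)) u) (inv (frechet_derivative (mul p) (at e)) v)"

definition bracket_span ::
    "('a::real_vector \<Rightarrow> 'a \<Rightarrow> 'a) \<Rightarrow> 'a set \<Rightarrow> 'a set \<Rightarrow> 'a set" where
  "bracket_span br S T = span {br u v | u v. u \<in> S \<and> v \<in> T}"

definition at_most_two_step_nilpotent :: "('a::real_vector \<Rightarrow> 'a \<Rightarrow> 'a) \<Rightarrow> bool" where
  "at_most_two_step_nilpotent br \<longleftrightarrow>
     bracket_span br UNIV (bracket_span br UNIV UNIV) = {0}"

definition nondegenerate_skew_form :: "(real^'m \<Rightarrow> real^'m \<Rightarrow> real) \<Rightarrow> bool" where
  "nondegenerate_skew_form \<omega> \<longleftrightarrow>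
     bilinear \<omega> \<and> (\<forall>x y. \<omega> x y = - \<omega> y x) \<and> (\<forall>x. (\<forall>y. \<omega> x y = 0) \<longrightarrow> x = 0)"

text \<open>Throughout, \<open>A x y\<close> and \<open>B x y\<close> stand for $\nabla_x y$ and $\nabla'_x y$.\<close>

definition affine_structure :: "(real^'m \<Rightarrow> real^'m \<Rightarrow> real^'m) \<Rightarrow> bool" where
  "affine_structure A \<longleftrightarrow>
     bilinear A \<and> (\<forall>x y. A x y = A y x) \<and> (\<forall>x y. A x \<circ> A y = A y \<circ> A x)"

definition compatible_with ::
    "(real^'m \<Rightarrow> real^'m \<Rightarrow> real) \<Rightarrow> (real^'m \<Rightarrow> real^'m \<Rightarrow> real^'m) \<Rightarrow> bool" where
  "compatible_with \<omega> A \<longleftrightarrow> (\<forall>x y z. \<omega> (A x y) z = \<omega> (A x z) y)"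

definition N_mult ::
    "(real^'m \<Rightarrow> real^'m \<Rightarrow> real^'m) \<Rightarrow> (real^'m \<Rightarrow> real^'m \<Rightarrow> real^'m) \<Rightarrow>
     (real^'m) \<times> (real^'m) \<Rightarrow> (real^'m) \<times> (real^'m) \<Rightarrow> (real^'m) \<times> (real^'m)" where
  "N_mult A B = (\<lambda>(x, x') (y, y').
     (x + y + B y x' - (1/2) *\<^sub>R B y (A y x'),
      x' - A x' y - (1/2) *\<^sub>R A x' (B x' y) + y'))"

definition n_bracket ::
    "(real^'m \<Rightarrow> real^'m \<Rightarrow> real^'m) \<Rightarrow> (real^'m \<Rightarrow> real^'m \<Rightarrow> real^'m) \<Rightarrow>
     (real^'m) \<times> (real^'m) \<Rightarrow> (real^'m) \<times> (real^'m) \<Rightarrow> (real^'m) \<times> (real^'m)" where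
  "n_bracket A B = (\<lambda>(x, x') (y, y'). (B y x' - B x y', A x y' - A y x'))"

definition n_metric ::
    "(real^'m \<Rightarrow> real^'m \<Rightarrow> real) \<Rightarrow>
     (real^'m) \<times> (real^'m) \<Rightarrow> (real^'m) \<times> (real^'m) \<Rightarrow> real" where
  "n_metric \<omega> = (\<lambda>(x, x') (y, y'). - \<omega> x y' + \<omega> x' y)"

text \<open>The differential of left translation by \<open>(x, x')\<close> at \<open>(0, 0)\<close> sends \<open>(u, u')\<close> to
  \<open>(u + B x' u, u' - A x' u - (1/2) *\<^sub>R A x' (B x' u))\<close>. It is bijective, since compatibility with
  a symplectic form forces \<open>B x' \<circ> B x' = (\<lambda>_. 0)\<close>.\<close>

definition hypersymplectic_metric ::
    "(real^'m \<Rightarrow> real^'m \<Rightarrow> real) \<Rightarrow>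
     (real^'m \<Rightarrow> real^'m \<Rightarrow> real^'m) \<Rightarrow> (real^'m \<Rightarrow> real^'m \<Rightarrow> real^'m) \<Rightarrow>
     (real^'m) \<times> (real^'m) \<Rightarrow> (real^'m) \<times> (real^'m) \<Rightarrow> (real^'m) \<times> (real^'m) \<Rightarrow> real" where
  "hypersymplectic_metric \<omega> A B = left_invariant_metric (N_mult A B) (0, 0) (n_metric \<omega>)"

end

theory Submission
  imports Defs
begin

text \<open>Write \<open>A x y\<close> and \<open>B x y\<close> for the two affine structures. Since every \<open>A x\<close> and \<open>B x\<close> is
  infinitesimally symplectic, the symmetries of the quadrilinear forms obtained from \<open>\<omega>\<close> force
  \<open>A x \<circ> A y = 0\<close>, \<open>B x \<circ> B y = 0\<close> and \<open>B y \<circ> A x = - A x \<circ> B y\<close>, and \<open>A x (B y z)\<close> is symmetric in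
  \<open>x\<close>, \<open>y\<close>, \<open>z\<close> (\<open>affine_structure_square_zero\<close>, \<open>anticommute\<close>). The double brackets of the Lie algebra
  are then sums of terms \<open>A x (B y z)\<close>, and every such term occurs as a component of a double
  bracket. This relates nilpotency to the vanishing of all \<open>A x \<circ> B y\<close> (\<open>two_step_iff\<close>).

  For the metric, let left translation identify each tangent space with the Lie algebra. In this
  frame the Levi-Civita connection is the derivative of components plus the product
  \<open>(x, x') \<cdot> v = (A x + B x') v\<close>, acting diagonally on both components of \<open>v\<close>: these operators are
  skew for the metric, and \<open>u \<cdot> v - v \<cdot> u\<close> is the Lie bracket. Hence the curvature at \<open>(x, x')\<close>,
  \<open>(y, y')\<close> is the commutator of the two operators minus the operator of the bracket, which by the
  relations above equals \<open>4 (A x \<circ> B y' - A y \<circ> B x')\<close> (\<open>lc_product_curvature\<close>). It vanishes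
  identically exactly when all \<open>A x \<circ> B y\<close> do.

  The passage from vector fields to the Lie algebra is \<open>flat_metric_iff\<close>, proved for arbitrary moving
  frames. It needs the uniqueness of the Levi-Civita connection (\<open>levi_civita_unique\<close>) and the identity
  \<open>X (Y f) - Y (X f) = [X, Y] f\<close> (\<open>deriv_along_commutator\<close>), which rests on the symmetry of second
  derivatives.\<close>

section \<open>Smooth maps\<close>

text \<open>The derivative of \<open>f\<close> in the constant direction \<open>v\<close>, as a function of the base point.\<close>

abbreviation dir_deriv :: "('a::euclidean_space \<Rightarrow> 'b::real_normed_vector) \<Rightarrow> 'a \<Rightarrow> 'a \<Rightarrow> 'b" where
  "dir_deriv f v \<equiv> (\<lambda>x. frechet_derivative f (at x) v)"

lemma times_cont_differentiable_mono_Suc: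
  "times_cont_differentiable (Suc k) f \<Longrightarrow> times_cont_differentiable k f"
proof (induction k arbitrary: f)
  case 0
  then have "f differentiable (at x)" for x by simp
  then show ?case
    by (auto intro!: continuous_at_imp_continuous_on differentiable_imp_continuous_within)
next
  case (Suc k)
  show ?case
    unfolding times_cont_differentiable.simps(2)[of k]
    using Suc.prems Suc.IH by (auto simp del: times_cont_differentiable.simps(1))
qed

lemma smooth_imp_differentiable: "smooth f \<Longrightarrow> f differentiable (at x)"
  unfolding smooth_def by (metis times_cont_differentiable.simps(2))

lemma smooth_imp_has_derivative:
  "smooth f \<Longrightarrow> (f has_derivative frechet_derivative f (at x)) (at x)"
  using frechet_derivative_works smooth_imp_differentiable by blast

lemma smooth_dir_deriv: "smooth f \<Longrightarrow> smooth (dir_deriv f v)"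
  unfolding smooth_def by (metis times_cont_differentiable.simps(2))

lemma smooth_imp_continuous_on: "smooth f \<Longrightarrow> continuous_on UNIV f"
  unfolding smooth_def by (metis times_cont_differentiable.simps(1))

lemma smooth_const: "smooth (\<lambda>x. c)"
proof -
  have "times_cont_differentiable k (\<lambda>x::'a. c)" for k and c :: 'b
    by (induction k arbitrary: c) auto
  then show ?thesis by (simp add: smooth_def)
qed

lemma frechet_derivative_bounded_linear:
  "bounded_linear T \<Longrightarrow> frechet_derivative T (at x) = T"
  by (metis bounded_linear_imp_has_derivative frechet_derivative_at)

lemma smooth_bounded_linear:
  assumes "bounded_linear T"
  shows "smooth T"
  unfolding smooth_def
proof
  fix k
  show "times_cont_differentiable k T"
  proof (cases k)
    case 0
    then show ?thesis using assms by (simp add: linear_continuous_on)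
  next
    case (Suc j)
    then show ?thesis
      using assms smooth_const
      by (auto simp: frechet_derivative_bounded_linear smooth_def bounded_linear_imp_differentiable)
  qed
qed

lemma times_cont_differentiable_add:
  assumes "times_cont_differentiable k f" "times_cont_differentiable k g"
  shows "times_cont_differentiable k (\<lambda>x. f x + g x)"
  using assms
proof (induction k arbitrary: f g)
  case 0
  then show ?case by (simp add: continuous_on_add)
next
  case (Suc k)
  have "frechet_derivative (\<lambda>x. f x + g x) (at x) v
      = frechet_derivative f (at x) v + frechet_derivative g (at x) v" for x v
    using Suc.prems
    by (auto intro!: frechet_derivative_at[symmetric, THEN fun_cong] has_derivative_add
        simp: frechet_derivative_works)
  then show ?case using Suc by simp
qed

lemma smooth_add: "smooth f \<Longrightarrow> smooth g \<Longrightarrow> smooth (\<lambda>x. f x + g x)"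
  by (simp add: smooth_def times_cont_differentiable_add)

lemma has_derivative_bounded_bilinear_frechet:
  assumes "bounded_bilinear P" "f differentiable (at x)" "g differentiable (at x)"
  shows "((\<lambda>x. P (f x) (g x)) has_derivative
     (\<lambda>v. P (f x) (frechet_derivative g (at x) v) + P (frechet_derivative f (at x) v) (g x))) (at x)"
  using assms(2,3) by (intro bounded_bilinear.FDERIV[OF assms(1)]) (simp_all add: frechet_derivative_works)

lemma times_cont_differentiable_bounded_bilinear:
  assumes "bounded_bilinear P" "times_cont_differentiable k f" "times_cont_differentiable k g"
  shows "times_cont_differentiable k (\<lambda>x. P (f x) (g x))"
  using assms(2,3)
proof (induction k arbitrary: f g)
  case 0
  then show ?case by (simp add: bounded_bilinear.continuous_on[OF assms(1)])
next
  case (Suc k)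
  have *: "((\<lambda>x. P (f x) (g x)) has_derivative
     (\<lambda>v. P (f x) (frechet_derivative g (at x) v) + P (frechet_derivative f (at x) v) (g x))) (at x)"
    for x
    by (rule has_derivative_bounded_bilinear_frechet[OF assms(1)]) (use Suc.prems in simp_all)
  have **: "frechet_derivative (\<lambda>x. P (f x) (g x)) (at x) v =
     P (f x) (frechet_derivative g (at x) v) + P (frechet_derivative f (at x) v) (g x)" for x v
    using fun_cong[OF frechet_derivative_at[OF *]] by simp
  have "times_cont_differentiable k f" "times_cont_differentiable k g"
    using Suc.prems times_cont_differentiable_mono_Suc by blast+
  then show ?case
    using Suc * by (auto simp: ** differentiable_def intro!: times_cont_differentiable_add)
qed

lemma smooth_bounded_bilinear:
  "bounded_bilinear P \<Longrightarrow> smooth f \<Longrightarrow> smooth g \<Longrightarrow> smooth (\<lambda>x. P (f x) (g x))"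
  by (simp add: smooth_def times_cont_differentiable_bounded_bilinear)

lemma smooth_scaleR: "smooth f \<Longrightarrow> smooth g \<Longrightarrow> smooth (\<lambda>x. f x *\<^sub>R g x)"
  by (rule smooth_bounded_bilinear[OF bounded_bilinear_scaleR])

lemma smooth_ident: "smooth (\<lambda>x. x)"
  by (simp add: smooth_bounded_linear)

lemma smooth_minus: "smooth g \<Longrightarrow> smooth (\<lambda>x. - g x)"
  using smooth_scaleR[OF smooth_const[of "-1"], of g] by simp

lemma smooth_diff: "smooth f \<Longrightarrow> smooth g \<Longrightarrow> smooth (\<lambda>x. f x - g x)"
  using smooth_add[OF _ smooth_minus, of f g] by simp

lemma smooth_inner_const: "smooth f \<Longrightarrow> smooth (\<lambda>x. f x \<bullet> b)"
  by (rule smooth_bounded_bilinear[OF bounded_bilinear_inner _ smooth_const])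

lemma smooth_sum:
  "finite I \<Longrightarrow> (\<And>i. i \<in> I \<Longrightarrow> smooth (f i)) \<Longrightarrow> smooth (\<lambda>x. \<Sum>i\<in>I. f i x)"
  by (induction I rule: finite_induct) (auto simp: smooth_const smooth_add)

lemma smooth_bounded_linear_compose:
  assumes "bounded_linear T" "smooth f"
  shows "smooth (\<lambda>x. T (f x))"
  using smooth_bounded_bilinear[OF bounded_bilinear.comp[OF bounded_bilinear_scaleR
        bounded_linear_ident assms(1)] smooth_const[of 1] assms(2)] by simp

lemma smooth_Pair:
  assumes "smooth f" "smooth g"
  shows "smooth (\<lambda>x. (f x, g x))"
proof -
  have "smooth (\<lambda>x. (f x, 0) + (0, g x))"
    by (intro smooth_add assms
        smooth_bounded_linear_compose[where T = "\<lambda>v. (v, 0)"]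
        smooth_bounded_linear_compose[where T = "\<lambda>v. (0, v)"]
        bounded_linear_Pair bounded_linear_ident bounded_linear_zero)
  then show ?thesis by simp
qed

section \<open>Derivatives along vector fields\<close>

lemma deriv_along_eqI: "(f has_derivative f') (at p) \<Longrightarrow> deriv_along X f p = f' (X p)"
  unfolding deriv_along_def by (drule frechet_derivative_at) simp

lemma deriv_along_add:
  assumes "smooth f" "smooth g"
  shows "deriv_along X (\<lambda>q. f q + g q) p = deriv_along X f p + deriv_along X g p"
  using deriv_along_eqI[OF has_derivative_add[OF smooth_imp_has_derivative[OF assms(1)]
        smooth_imp_has_derivative[OF assms(2)]], of X]
  by (simp add: deriv_along_def)

lemma deriv_along_bounded_bilinear:
  assumes "bounded_bilinear P" "smooth f" "smooth g"
  shows "deriv_along X (\<lambda>q. P (f q) (g q)) p = P (f p) (deriv_along X g p) + P (deriv_along X f p) (g p)"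
  using deriv_along_eqI[OF has_derivative_bounded_bilinear_frechet[OF assms(1)
        smooth_imp_differentiable[OF assms(2)] smooth_imp_differentiable[OF assms(3)]], of X]
  by (simp add: deriv_along_def)

lemma deriv_along_linear_field:
  assumes "smooth f"
  shows "deriv_along (\<lambda>p. X p + Y p) f p = deriv_along X f p + deriv_along Y f p"
    and "deriv_along (\<lambda>p. c p *\<^sub>R X p) f p = c p *\<^sub>R deriv_along X f p"
    and "deriv_along (\<lambda>p. X p - Y p) f p = deriv_along X f p - deriv_along Y f p"
  using linear_frechet_derivative[OF smooth_imp_differentiable[OF assms]]
  by (simp_all add: deriv_along_def linear_add linear_cmul linear_diff)

text \<open>Expanding \<open>X\<close> in the standard basis reduces derivatives along fields to directional derivatives
  in constant directions, for which smoothness is defined.\<close>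

lemma deriv_along_eq_sum:
  assumes "smooth f"
  shows "deriv_along X f p = (\<Sum>b\<in>Basis. (X p \<bullet> b) *\<^sub>R dir_deriv f b p)"
  unfolding deriv_along_def
  by (subst euclidean_representation[of "X p", symmetric],
      subst linear_sum[OF linear_frechet_derivative[OF smooth_imp_differentiable[OF assms]]])
    (simp add: linear_cmul[OF linear_frechet_derivative[OF smooth_imp_differentiable[OF assms]]])

lemma smooth_deriv_along:
  assumes "smooth X" "smooth f"
  shows "smooth (deriv_along X f)"
proof -
  have "deriv_along X f = (\<lambda>p. \<Sum>b\<in>Basis. (X p \<bullet> b) *\<^sub>R dir_deriv f b p)"
    using deriv_along_eq_sum[OF assms(2)] by blast
  then show ?thesis
    using assms by (auto intro!: smooth_sum smooth_scaleR smooth_inner_const smooth_dir_deriv)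
qed

lemma smooth_field_bracket:
  "smooth X \<Longrightarrow> smooth Y \<Longrightarrow> smooth (field_bracket X Y)"
  unfolding field_bracket_def by (intro smooth_diff smooth_deriv_along)

section \<open>Symmetry of second derivatives\<close>

lemma has_real_derivative_along_line:
  fixes f :: "'a::euclidean_space \<Rightarrow> real"
  assumes "smooth f"
  shows "((\<lambda>s. f (c + s *\<^sub>R a)) has_real_derivative dir_deriv f a (c + s *\<^sub>R a)) (at s)"
proof -
  have "((\<lambda>s. f (c + s *\<^sub>R a)) has_derivative
      (\<lambda>r. frechet_derivative f (at (c + s *\<^sub>R a)) (r *\<^sub>R a))) (at s)"
    by (rule has_derivative_compose[OF _ smooth_imp_has_derivative[OF assms]])
      (auto intro!: derivative_eq_intros)
  then show ?thesis
    using linear_cmul[OF linear_frechet_derivative[OF smooth_imp_differentiable[OF assms]]]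
    by (simp add: has_field_derivative_def mult_commute_abs)
qed

text \<open>The mean value theorem, used once in each direction, expresses the second difference over
  a parallelogram by a mixed second derivative at an intermediate point.\<close>

lemma second_difference_mean_value:
  fixes f :: "'a::euclidean_space \<Rightarrow> real"
  assumes "smooth f" "h > 0"
  shows "\<exists>r t. 0 < r \<and> r < h \<and> 0 < t \<and> t < h \<and>
    f (p + h *\<^sub>R a + h *\<^sub>R b) - f (p + h *\<^sub>R a) - f (p + h *\<^sub>R b) + f p
      = h * (h * dir_deriv (dir_deriv f a) b (p + r *\<^sub>R a + t *\<^sub>R b))"
proof -
  define u where "u = (\<lambda>s. f ((p + h *\<^sub>R b) + s *\<^sub>R a) - f (p + s *\<^sub>R a))"
  have "(u has_real_derivative
      (dir_deriv f a ((p + h *\<^sub>R b) + s *\<^sub>R a) - dir_deriv f a (p + s *\<^sub>R a))) (at s)" for s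
    unfolding u_def
    by (intro DERIV_diff has_real_derivative_along_line assms)
  then obtain r where r: "0 < r" "r < h"
    "u h - u 0 = (h - 0) * (dir_deriv f a ((p + h *\<^sub>R b) + r *\<^sub>R a) - dir_deriv f a (p + r *\<^sub>R a))"
    using MVT2[OF assms(2), of u
        "\<lambda>s. dir_deriv f a ((p + h *\<^sub>R b) + s *\<^sub>R a) - dir_deriv f a (p + s *\<^sub>R a)"] by blast
  obtain t where t: "0 < t" "t < h"
    "dir_deriv f a ((p + r *\<^sub>R a) + h *\<^sub>R b) - dir_deriv f a ((p + r *\<^sub>R a) + 0 *\<^sub>R b)
      = (h - 0) * dir_deriv (dir_deriv f a) b ((p + r *\<^sub>R a) + t *\<^sub>R b)"
    using MVT2[OF assms(2), of "\<lambda>t. dir_deriv f a ((p + r *\<^sub>R a) + t *\<^sub>R b)"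
        "\<lambda>t. dir_deriv (dir_deriv f a) b ((p + r *\<^sub>R a) + t *\<^sub>R b)"]
      has_real_derivative_along_line[OF smooth_dir_deriv[OF assms(1)]] by blast
  have "u h - u 0 = h * (h * dir_deriv (dir_deriv f a) b ((p + r *\<^sub>R a) + t *\<^sub>R b))"
    using r(3) t(3) by (simp add: algebra_simps)
  moreover have "u h - u 0 = f (p + h *\<^sub>R a + h *\<^sub>R b) - f (p + h *\<^sub>R a) - f (p + h *\<^sub>R b) + f p"
    by (simp add: u_def algebra_simps)
  ultimately show ?thesis using r t by auto
qed

lemma second_derivative_symmetric_real:
  fixes f :: "'a::euclidean_space \<Rightarrow> real"
  assumes "smooth f"
  shows "dir_deriv (dir_deriv f a) b p = dir_deriv (dir_deriv f b) a p"
proof -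
  let ?F = "dir_deriv (dir_deriv f a) b" and ?G = "dir_deriv (dir_deriv f b) a"
  define h where "h = (\<lambda>n. 1 / real (Suc n))"
  have h: "h n > 0" for n by (simp add: h_def)
  have h0: "h \<longlonglongrightarrow> 0" unfolding h_def by (rule LIMSEQ_Suc[OF lim_1_over_n])
  \<comment> \<open>The second difference is symmetric in \<open>a\<close> and \<open>b\<close>, so both mixed derivatives agree at suitable
    points of arbitrarily small parallelograms.\<close>
  obtain r t where rt: "\<And>n. 0 < r n \<and> r n < h n \<and> 0 < t n \<and> t n < h n \<and>
     f (p + h n *\<^sub>R a + h n *\<^sub>R b) - f (p + h n *\<^sub>R a) - f (p + h n *\<^sub>R b) + f p
     = h n * (h n * ?F (p + r n *\<^sub>R a + t n *\<^sub>R b))"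
    using second_difference_mean_value[OF assms h, where p = p and a = a and b = b] by metis
  obtain r' t' where rt': "\<And>n. 0 < r' n \<and> r' n < h n \<and> 0 < t' n \<and> t' n < h n \<and>
     f (p + h n *\<^sub>R b + h n *\<^sub>R a) - f (p + h n *\<^sub>R b) - f (p + h n *\<^sub>R a) + f p
     = h n * (h n * ?G (p + r' n *\<^sub>R b + t' n *\<^sub>R a))"
    using second_difference_mean_value[OF assms h, where p = p and a = b and b = a] by metis
  have null: "x \<longlonglongrightarrow> 0" if "\<And>n. 0 < x n \<and> x n < h n" for x :: "nat \<Rightarrow> real"
    by (rule tendsto_sandwich[OF _ _ tendsto_const h0]) (auto simp: that less_imp_le)
  have lim: "(\<lambda>n. K (p + x n *\<^sub>R c + y n *\<^sub>R d)) \<longlonglongrightarrow> K p"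
    if "smooth K" "x \<longlonglongrightarrow> 0" "y \<longlonglongrightarrow> 0" for K :: "'a \<Rightarrow> real" and x y c d
  proof -
    have "isCont K p"
      using smooth_imp_continuous_on[OF that(1)] by (simp add: continuous_on_eq_continuous_at)
    moreover have "(\<lambda>n. p + x n *\<^sub>R c + y n *\<^sub>R d) \<longlonglongrightarrow> p + 0 *\<^sub>R c + 0 *\<^sub>R d"
      by (intro tendsto_intros that)
    ultimately show ?thesis using isCont_tendsto_compose by fastforce
  qed
  have eq: "?F (p + r n *\<^sub>R a + t n *\<^sub>R b) = ?G (p + r' n *\<^sub>R b + t' n *\<^sub>R a)" for n
  proof -
    have "h n * (h n * ?F (p + r n *\<^sub>R a + t n *\<^sub>R b)) = h n * (h n * ?G (p + r' n *\<^sub>R b + t' n *\<^sub>R a))"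
      using rt[of n] rt'[of n] by (simp add: algebra_simps)
    then show ?thesis using h[of n] by simp
  qed
  have "(\<lambda>n. ?F (p + r n *\<^sub>R a + t n *\<^sub>R b)) \<longlonglongrightarrow> ?F p"
    using rt by (intro lim smooth_dir_deriv assms null) blast+
  moreover have "(\<lambda>n. ?F (p + r n *\<^sub>R a + t n *\<^sub>R b)) \<longlonglongrightarrow> ?G p"
    unfolding eq using rt' by (intro lim smooth_dir_deriv assms null) blast+
  ultimately show ?thesis using LIMSEQ_unique by blast
qed

lemma second_derivative_symmetric:
  fixes f :: "'a::euclidean_space \<Rightarrow> 'b::euclidean_space"
  assumes "smooth f"
  shows "dir_deriv (dir_deriv f a) b p = dir_deriv (dir_deriv f b) a p"
proof (rule euclidean_eqI)
  fix e :: 'b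
  have inner: "dir_deriv (\<lambda>x. g x \<bullet> e) v x = dir_deriv g v x \<bullet> e"
    if "smooth g" for g :: "'a \<Rightarrow> 'b" and v x
    using deriv_along_eqI[OF bounded_linear.has_derivative[OF bounded_linear_inner_left[of e]
        smooth_imp_has_derivative[OF that]], where X = "\<lambda>_. v" and p = x]
    by (simp add: deriv_along_def)
  show "dir_deriv (dir_deriv f a) b p \<bullet> e = dir_deriv (dir_deriv f b) a p \<bullet> e"
    using second_derivative_symmetric_real[where a = a and b = b and p = p,
        OF smooth_inner_const[OF assms, of e]]
    by (simp add: inner[OF assms] inner[OF smooth_dir_deriv[OF assms]])
qed

text \<open>In \<open>dir_deriv (dir_deriv f (Y p)) (X p) p\<close> the direction \<open>Y p\<close> is kept constant while
  differentiating, so this is the Hessian of \<open>f\<close> at \<open>p\<close>; the variation of \<open>Y\<close> is in the other term.\<close>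

lemma deriv_along_twice:
  assumes "smooth Y" "smooth f"
  shows "deriv_along X (deriv_along Y f) p
    = deriv_along (deriv_along X Y) f p + dir_deriv (dir_deriv f (Y p)) (X p) p"
proof -
  have lin: "linear (frechet_derivative f (at x))" for x
    by (rule linear_frechet_derivative[OF smooth_imp_differentiable[OF assms(2)]])
  have "deriv_along Y f = (\<lambda>p. \<Sum>b\<in>Basis. (Y p \<bullet> b) *\<^sub>R dir_deriv f b p)"
    using deriv_along_eq_sum[OF assms(2)] by blast
  moreover have "((\<lambda>p. \<Sum>b\<in>Basis. (Y p \<bullet> b) *\<^sub>R dir_deriv f b p) has_derivative
     (\<lambda>v. \<Sum>b\<in>Basis. (Y p \<bullet> b) *\<^sub>R dir_deriv (dir_deriv f b) v p
        + (dir_deriv Y v p \<bullet> b) *\<^sub>R dir_deriv f b p)) (at p)"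
    by (intro has_derivative_sum has_derivative_scaleR has_derivative_inner_left
        smooth_imp_has_derivative smooth_dir_deriv assms)
  ultimately have "deriv_along X (deriv_along Y f) p =
     (\<Sum>b\<in>Basis. (Y p \<bullet> b) *\<^sub>R dir_deriv (dir_deriv f b) (X p) p)
      + (\<Sum>b\<in>Basis. (deriv_along X Y p \<bullet> b) *\<^sub>R dir_deriv f b p)"
    by (simp add: deriv_along_eqI sum.distrib) (simp add: deriv_along_def)
  moreover have "(\<Sum>b\<in>Basis. (deriv_along X Y p \<bullet> b) *\<^sub>R dir_deriv f b p) = deriv_along (deriv_along X Y) f p"
    using deriv_along_eq_sum[OF assms(2)] by metis
  moreover have "(\<Sum>b\<in>Basis. (Y p \<bullet> b) *\<^sub>R dir_deriv (dir_deriv f b) (X p) p)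
      = dir_deriv (dir_deriv f (Y p)) (X p) p"
  proof -
    have "((\<lambda>x. \<Sum>b\<in>Basis. (Y p \<bullet> b) *\<^sub>R dir_deriv f b x) has_derivative
      (\<lambda>v. \<Sum>b\<in>Basis. (Y p \<bullet> b) *\<^sub>R dir_deriv (dir_deriv f b) v p)) (at p)"
      by (intro has_derivative_sum has_derivative_scaleR_right smooth_imp_has_derivative
          smooth_dir_deriv assms)
    moreover have "(\<lambda>x. \<Sum>b\<in>Basis. (Y p \<bullet> b) *\<^sub>R dir_deriv f b x) = dir_deriv f (Y p)"
    proof
      fix x
      show "(\<Sum>b\<in>Basis. (Y p \<bullet> b) *\<^sub>R dir_deriv f b x) = dir_deriv f (Y p) x"
        using deriv_along_eq_sum[OF assms(2), of "\<lambda>_. Y p" x] by (simp add: deriv_along_def)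
    qed
    ultimately have "(dir_deriv f (Y p) has_derivative
      (\<lambda>v. \<Sum>b\<in>Basis. (Y p \<bullet> b) *\<^sub>R dir_deriv (dir_deriv f b) v p)) (at p)" by simp
    then show ?thesis using deriv_along_eqI[of "dir_deriv f (Y p)" _ p X] by (simp add: deriv_along_def)
  qed
  ultimately show ?thesis by simp
qed

lemma deriv_along_commutator:
  fixes f :: "'a::euclidean_space \<Rightarrow> 'b::euclidean_space"
  assumes "smooth X" "smooth Y" "smooth f"
  shows "deriv_along X (deriv_along Y f) p - deriv_along Y (deriv_along X f) p
    = deriv_along (field_bracket X Y) f p"
  using deriv_along_twice[OF assms(2,3), of X p]
    deriv_along_twice[OF assms(1,3), of Y p]
    second_derivative_symmetric[where a = "X p" and b = "Y p" and p = p, OF assms(3)]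
    deriv_along_linear_field(3)[OF assms(3), of "deriv_along X Y" "deriv_along Y X" p]
  by (simp add: field_bracket_def)

section \<open>The Levi-Civita connection in a moving frame\<close>

text \<open>A moving frame on Euclidean space: \<open>\<theta> p\<close> identifies the tangent space at \<open>p\<close> with a fixed
  space carrying a metric \<open>h\<close>, a bracket \<open>br\<close> and a bilinear product \<open>L\<close>; \<open>M p\<close> is its inverse and
  \<open>d\<theta> p a\<close> its derivative at \<open>p\<close> in direction \<open>a\<close>. The structure equation says that frame fields,
  those on which \<open>\<theta>\<close> is constant, are closed under the bracket of vector fields and obey \<open>br\<close>. For
  such fields \<open>L\<close> will be the Levi-Civita connection of the metric that \<open>\<theta>\<close> transports from \<open>h\<close>.\<close>

locale moving_frame =
  fixes \<theta> M :: "'a::euclidean_space \<Rightarrow> 'a \<Rightarrow> 'a"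
    and d\<theta> :: "'a \<Rightarrow> 'a \<Rightarrow> 'a \<Rightarrow> 'a"
    and br L :: "'a \<Rightarrow> 'a \<Rightarrow> 'a"
    and h :: "'a \<Rightarrow> 'a \<Rightarrow> real"
  assumes linear_frame: "linear (\<theta> p)"
    and linear_inverse: "linear (M p)"
    and frame_inverse: "\<theta> p (M p v) = v"
    and inverse_frame: "M p (\<theta> p v) = v"
    and smooth_frame: "smooth Y \<Longrightarrow> smooth (\<lambda>p. \<theta> p (Y p))"
    and smooth_inverse: "smooth Y \<Longrightarrow> smooth (\<lambda>p. M p (Y p))"
    and deriv_along_frame:
      "smooth Y \<Longrightarrow> deriv_along X (\<lambda>q. \<theta> q (Y q)) p = \<theta> p (deriv_along X Y p) + d\<theta> p (X p) (Y p)"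
    and bilinear_L: "bounded_bilinear L"
    and bilinear_h: "bounded_bilinear h"
    and h_sym: "h u v = h v u"
    and h_nondegenerate: "(\<And>v. h u v = 0) \<Longrightarrow> u = 0"
    and L_skew: "h (L u v) w + h v (L u w) = 0"
    and L_torsion_free: "L u v - L v u = br u v"
    and structure_equation: "d\<theta> p b a - d\<theta> p a b = br (\<theta> p a) (\<theta> p b)"
begin

sublocale L: bounded_bilinear L by (rule bilinear_L)
sublocale h: bounded_bilinear h by (rule bilinear_h)

text \<open>Differentiate the components with respect to the frame and add the product \<open>L\<close>.\<close>

definition conn :: "'a connection" where
  "conn X Y = (\<lambda>p. M p (deriv_along X (\<lambda>q. \<theta> q (Y q)) p + L (\<theta> p (X p)) (\<theta> p (Y p))))"

lemmas frame_simps =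
  linear_add[OF linear_frame] linear_diff[OF linear_frame] linear_cmul[OF linear_frame]
lemmas inverse_simps =
  linear_add[OF linear_inverse] linear_diff[OF linear_inverse] linear_cmul[OF linear_inverse]

lemma frame_conn:
  "\<theta> p (conn X Y p) = deriv_along X (\<lambda>q. \<theta> q (Y q)) p + L (\<theta> p (X p)) (\<theta> p (Y p))"
  by (simp add: conn_def frame_inverse)

lemma smooth_conn: "smooth X \<Longrightarrow> smooth Y \<Longrightarrow> smooth (conn X Y)"
  unfolding conn_def
  by (intro smooth_inverse smooth_add smooth_deriv_along smooth_frame
      smooth_bounded_bilinear[OF bilinear_L])

lemma affine_connection_conn: "affine_connection conn"
  unfolding affine_connection_def
proof (intro conjI allI impI ext)
  show "smooth (conn X Y)" if "smooth X" "smooth Y" for X Y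
    using that by (rule smooth_conn)
  show "conn (\<lambda>p. X p + X' p) Y p = conn X Y p + conn X' Y p"
    if "smooth X" "smooth X'" "smooth Y" for X X' Y p
    using that
    by (simp add: conn_def deriv_along_linear_field smooth_frame frame_simps inverse_simps L.add_left)
  show "conn (\<lambda>p. f p *\<^sub>R X p) Y p = f p *\<^sub>R conn X Y p"
    if "smooth f" "smooth X" "smooth Y" for f X Y p
    using that
    by (simp add: conn_def deriv_along_linear_field smooth_frame frame_simps inverse_simps
        L.scaleR_left scaleR_add_right)
  show "conn X (\<lambda>p. Y p + Y' p) p = conn X Y p + conn X Y' p"
    if "smooth X" "smooth Y" "smooth Y'" for X Y Y' p
    using that
    by (simp add: conn_def deriv_along_add smooth_frame frame_simps inverse_simps L.add_right)
  show "conn X (\<lambda>p. f p *\<^sub>R Y p) p = deriv_along X f p *\<^sub>R Y p + f p *\<^sub>R conn X Y p"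
    if "smooth f" "smooth X" "smooth Y" for f X Y p
    using that
    by (simp add: conn_def deriv_along_bounded_bilinear[OF bounded_bilinear_scaleR] smooth_frame
        frame_simps inverse_simps inverse_frame L.scaleR_right scaleR_add_right)
qed

lemma frame_field_bracket:
  assumes "smooth X" "smooth Y"
  shows "\<theta> p (field_bracket X Y p) = deriv_along X (\<lambda>q. \<theta> q (Y q)) p
    - deriv_along Y (\<lambda>q. \<theta> q (X q)) p + br (\<theta> p (X p)) (\<theta> p (Y p))"
  using structure_equation[of p "Y p" "X p"] assms
  by (simp add: field_bracket_def frame_simps deriv_along_frame algebra_simps)

lemma levi_civita_conn: "levi_civita (\<lambda>p u v. h (\<theta> p u) (\<theta> p v)) conn"
  unfolding levi_civita_def
proof (intro conjI allI impI)
  show "affine_connection conn" by (rule affine_connection_conn)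
  show "conn X Y p - conn Y X p = field_bracket X Y p" if "smooth X" "smooth Y" for X Y p
  proof -
    have "\<theta> p (conn X Y p - conn Y X p) = \<theta> p (field_bracket X Y p)"
      using L_torsion_free[of "\<theta> p (X p)" "\<theta> p (Y p)", symmetric]
      by (simp add: frame_simps frame_conn frame_field_bracket that)
    then show ?thesis by (metis inverse_frame)
  qed
  show "deriv_along X (\<lambda>q. h (\<theta> q (Y q)) (\<theta> q (Z q))) p
      = h (\<theta> p (conn X Y p)) (\<theta> p (Z p)) + h (\<theta> p (Y p)) (\<theta> p (conn X Z p))"
    if "smooth X" "smooth Y" "smooth Z" for X Y Z p
    using L_skew[of "\<theta> p (X p)" "\<theta> p (Y p)" "\<theta> p (Z p)"] that
    by (simp add: frame_conn deriv_along_bounded_bilinear[OF bilinear_h] smooth_frame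
        h.add_left h.add_right)
qed

text \<open>The difference of two Levi-Civita connections is symmetric in its arguments and skew with
  respect to the metric, and a trilinear expression that is symmetric in one pair of arguments and
  skew in an overlapping pair vanishes.\<close>

lemma levi_civita_unique:
  assumes "levi_civita (\<lambda>p u v. h (\<theta> p u) (\<theta> p v)) D" "smooth X" "smooth Y"
  shows "D X Y = conn X Y"
proof
  fix p
  define S where "S = (\<lambda>X Y. \<theta> p (D X Y p) - \<theta> p (conn X Y p))"
  note D = assms(1)[unfolded levi_civita_def] levi_civita_conn[unfolded levi_civita_def]
  have sym: "S X Y = S Y X" if "smooth X" "smooth Y" for X Y
  proof -
    have "D X Y p - D Y X p = conn X Y p - conn Y X p"
      using D that by simp
    then have "\<theta> p (D X Y p - D Y X p) = \<theta> p (conn X Y p - conn Y X p)" by simp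
    then show ?thesis by (simp add: S_def frame_simps algebra_simps)
  qed
  have skew: "h (S X Y) (\<theta> p (Z p)) = - h (\<theta> p (Y p)) (S X Z)"
    if "smooth X" "smooth Y" "smooth Z" for X Y Z
  proof -
    have "h (\<theta> p (D X Y p)) (\<theta> p (Z p)) + h (\<theta> p (Y p)) (\<theta> p (D X Z p)) =
       h (\<theta> p (conn X Y p)) (\<theta> p (Z p)) + h (\<theta> p (Y p)) (\<theta> p (conn X Z p))"
      using D that by metis
    then show ?thesis by (simp add: S_def h.diff_left h.diff_right)
  qed
  have "h (S X Y) w = 0" for w
  proof -
    let ?Z = "\<lambda>_::'a. M p w"
    have Z: "smooth ?Z" by (rule smooth_const)
    have "h (S X Y) (\<theta> p (?Z p)) = - h (S X ?Z) (\<theta> p (Y p))"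
      using skew[OF assms(2,3) Z] h_sym by metis
    also have "\<dots> = h (S ?Z Y) (\<theta> p (X p))"
      using skew[OF Z assms(2,3)] h_sym sym[OF assms(2) Z] by simp
    also have "\<dots> = - h (S Y X) (\<theta> p (?Z p))"
      using skew[OF assms(3) Z assms(2)] h_sym sym[OF assms(3) Z] by simp
    finally show ?thesis using sym[OF assms(2,3)] by (simp add: frame_inverse)
  qed
  then have "\<theta> p (D X Y p) = \<theta> p (conn X Y p)"
    using h_nondegenerate by (fastforce simp: S_def)
  then show "D X Y p = conn X Y p" by (metis inverse_frame)
qed

text \<open>The derivatives of the components cancel by the commutator identity for derivatives along fields,
  leaving the curvature of the product \<open>L\<close>.\<close>

lemma curvature_conn:
  assumes "smooth X" "smooth Y" "smooth Z"
    and "u = \<theta> p (X p)" "v = \<theta> p (Y p)" "w = \<theta> p (Z p)"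
  shows "\<theta> p (curvature conn X Y Z p) = L u (L v w) - L v (L u w) - L (br u v) w"
proof -
  let ?F = "\<lambda>X q. \<theta> q (X q)"
  have second: "\<theta> p (conn X (conn Y Z) p) =
      deriv_along X (deriv_along Y (?F Z)) p + L (?F Y p) (deriv_along X (?F Z) p)
      + L (deriv_along X (?F Y) p) (?F Z p) + L (?F X p) (deriv_along Y (?F Z) p)
      + L (?F X p) (L (?F Y p) (?F Z p))"
    if "smooth X" "smooth Y" for X Y
    using that assms(3)
    by (simp add: frame_conn deriv_along_add smooth_frame smooth_deriv_along
        smooth_bounded_bilinear[OF bilinear_L] deriv_along_bounded_bilinear[OF bilinear_L]
        L.add_right)
  have "\<theta> p (curvature conn X Y Z p) = \<theta> p (conn X (conn Y Z) p) - \<theta> p (conn Y (conn X Z) p)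
      - \<theta> p (conn (field_bracket X Y) Z p)"
    by (simp add: curvature_def frame_simps)
  also have "\<dots> = deriv_along X (deriv_along Y (?F Z)) p - deriv_along Y (deriv_along X (?F Z)) p
      - deriv_along (field_bracket X Y) (?F Z) p + (L u (L v w) - L v (L u w) - L (br u v) w)"
    using assms(1,2)
    by (simp add: second frame_conn[of p "field_bracket X Y" Z] frame_field_bracket
        L.add_left L.diff_left assms(4-6))
  also have "\<dots> = L u (L v w) - L v (L u w) - L (br u v) w"
    using deriv_along_commutator[OF assms(1,2) smooth_frame[OF assms(3)], of p] by simp
  finally show ?thesis .
qed

lemma flat_metric_iff:
  "flat_metric (\<lambda>p u v. h (\<theta> p u) (\<theta> p v)) \<longleftrightarrow>
    (\<forall>u v w. L u (L v w) - L v (L u w) - L (br u v) w = 0)"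
proof
  assume "flat_metric (\<lambda>p u v. h (\<theta> p u) (\<theta> p v))"
  then obtain D where D: "levi_civita (\<lambda>p u v. h (\<theta> p u) (\<theta> p v)) D"
    and flat: "\<And>X Y Z p. smooth X \<Longrightarrow> smooth Y \<Longrightarrow> smooth Z \<Longrightarrow> curvature D X Y Z p = 0"
    unfolding flat_metric_def by blast
  show "\<forall>u v w. L u (L v w) - L v (L u w) - L (br u v) w = 0"
  proof (intro allI)
    fix u v w :: 'a
    \<comment> \<open>Only the values of the fields at \<open>0\<close> enter, so constant fields suffice.\<close>
    let ?X = "\<lambda>_::'a. M 0 u" and ?Y = "\<lambda>_::'a. M 0 v" and ?Z = "\<lambda>_::'a. M 0 w"
    have "curvature conn ?X ?Y ?Z 0 = curvature D ?X ?Y ?Z 0"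
      by (simp add: curvature_def levi_civita_unique[OF D] smooth_const smooth_conn
          smooth_field_bracket)
    also have "\<dots> = 0"
      by (intro flat smooth_const)
    finally show "L u (L v w) - L v (L u w) - L (br u v) w = 0"
      using curvature_conn[of ?X ?Y ?Z u 0 v w]
      by (simp add: smooth_const frame_inverse linear_0[OF linear_frame])
  qed
next
  assume zero: "\<forall>u v w. L u (L v w) - L v (L u w) - L (br u v) w = 0"
  have "curvature conn X Y Z p = 0" if "smooth X" "smooth Y" "smooth Z" for X Y Z p
  proof -
    have "\<theta> p (curvature conn X Y Z p) = \<theta> p 0"
      using curvature_conn[OF that] zero linear_0[OF linear_frame] by metis
    then show ?thesis by (metis inverse_frame)
  qed
  then show "flat_metric (\<lambda>p u v. h (\<theta> p u) (\<theta> p v))"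
    unfolding flat_metric_def using levi_civita_conn by blast
qed

end

section \<open>Pairs of compatible affine structures\<close>

lemma bounded_bilinear_if_bilinear:
  fixes f :: "'a::euclidean_space \<Rightarrow> 'b::euclidean_space \<Rightarrow> 'c::real_normed_vector"
  shows "bilinear f \<Longrightarrow> bounded_bilinear f"
  by (simp add: bilinear_conv_bounded_bilinear)

text \<open>The form \<open>\<omega> (A x (A y z)) w\<close> is symmetric in \<open>x\<close>, \<open>y\<close>, \<open>z\<close>. Each \<open>A x\<close> is skew with respect to
  \<open>\<omega>\<close>, so moving both operators across \<open>\<omega>\<close> shows that the form is skew in \<open>z\<close>, \<open>w\<close>.\<close>

lemma affine_structure_square_zero:
  assumes "nondegenerate_skew_form \<omega>" "affine_structure A" "compatible_with \<omega> A"
  shows "A x (A y z) = 0"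
proof -
  define F where "F = (\<lambda>x y z w. \<omega> (A x (A y z)) w)"
  have w: "\<omega> u v = - \<omega> v u" "(\<And>v. \<omega> u v = 0) \<Longrightarrow> u = 0" for u v
    using assms(1) unfolding nondegenerate_skew_form_def by blast+
  have A: "A u v = A v u" "A u (A v t) = A v (A u t)" for u v t
    using assms(2) unfolding affine_structure_def by (auto simp: fun_eq_iff)
  have c: "\<omega> (A u v) t = \<omega> (A u t) v" for u v t
    using assms(3) unfolding compatible_with_def by blast
  have s1: "F x y z w = F y x z w" for x y z w
    unfolding F_def using A(2) by simp
  have s2: "F x y z w = F x z y w" for x y z w
    unfolding F_def using A(1) by metis
  have s3: "F x y z w = - F x y w z" for x y z w
  proof -
    have "F x y z w = \<omega> (A x w) (A y z)" by (simp add: F_def c)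
    also have "\<dots> = - \<omega> (A y z) (A x w)" by (rule w)
    also have "\<dots> = - F y x w z" by (simp add: F_def c)
    finally show ?thesis using s1 by simp
  qed
  \<comment> \<open>Symmetric in one pair of arguments and skew in an overlapping one.\<close>
  have "F x y z w = 0" for x y z w
    using s3[of x y z w] s2[of x y w z] s3[of x w y z] s2[of x w z y] s3[of x z w y] s2[of x z y w]
    by linarith
  then show ?thesis using w(2) unfolding F_def by blast
qed

text \<open>Two affine structures compatible with the same symplectic form, linked by the condition
  under which the double product is a Lie group.\<close>

locale compatible_pair =
  fixes \<omega> :: "real^'m \<Rightarrow> real^'m \<Rightarrow> real"
    and A B :: "real^'m \<Rightarrow> real^'m \<Rightarrow> real^'m"
  assumes symplectic: "nondegenerate_skew_form \<omega>"
    and affine_A: "affine_structure A" and affine_B: "affine_structure B"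
    and compatible_A: "compatible_with \<omega> A" and compatible_B: "compatible_with \<omega> B"
    and mixed: "A x (B y z) = A y (B x z)"
begin

lemma skew: "\<omega> u v = - \<omega> v u"
  using symplectic unfolding nondegenerate_skew_form_def by blast

lemma nondegenerate: "(\<And>v. \<omega> u v = 0) \<Longrightarrow> u = 0"
  using symplectic unfolding nondegenerate_skew_form_def by blast

lemma compat: "\<omega> (A u v) t = \<omega> (A u t) v" "\<omega> (B u v) t = \<omega> (B u t) v"
  using compatible_A compatible_B unfolding compatible_with_def by blast+

lemma commute: "A u v = A v u" "B u v = B v u"
  using affine_A affine_B unfolding affine_structure_def by blast+

sublocale A: bounded_bilinear A
  using affine_A bounded_bilinear_if_bilinear unfolding affine_structure_def by blast
sublocale B: bounded_bilinear B
  using affine_B bounded_bilinear_if_bilinear unfolding affine_structure_def by blast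
sublocale \<omega>: bounded_bilinear \<omega>
  using symplectic bounded_bilinear_if_bilinear unfolding nondegenerate_skew_form_def by blast

lemma square_zero: "A x (A y z) = 0" "B x (B y z) = 0"
  by (rule affine_structure_square_zero[OF symplectic affine_A compatible_A],
      rule affine_structure_square_zero[OF symplectic affine_B compatible_B])

lemma square_zero_left: "A (A x y) z = 0" "B (B x y) z = 0"
  by (simp_all add: square_zero commute(1)[of "A x y"] commute(2)[of "B x y"])

lemma mixed_commute: "A x (B y z) = A x (B z y)"
  by (simp add: commute)

lemma mixed_skew: "\<omega> (A x (B y z)) w = - \<omega> (B y (A x w)) z"
proof -
  have "\<omega> (A x (B y z)) w = - \<omega> (B y z) (A x w)"
    using compat(1)[of x "B y z" w] skew[of "A x w"] by simp
  then show ?thesis using compat(2)[of y z "A x w"] by simp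
qed

text \<open>The quadrilinear form \<open>\<omega> (A x (B y z)) w\<close> is symmetric in \<open>x\<close>, \<open>y\<close>, \<open>z\<close>. Moving both operators
  across \<open>\<omega>\<close> gives \<open>- \<omega> (B y (A x w)) z\<close>, which is symmetric in \<open>x\<close>, \<open>w\<close>. Hence the form is
  symmetric in all arguments, and exchanging \<open>z\<close> and \<open>w\<close> yields the claim.\<close>

lemma anticommute: "B y (A x z) = - A x (B y z)"
proof -
  define G where "G = (\<lambda>x y z w. \<omega> (A x (B y z)) w)"
  have g1: "G x y z w = G y x z w" for x y z w by (simp add: G_def mixed[of x])
  have g2: "G x y z w = G x z y w" for x y z w by (simp add: G_def mixed_commute[of x y])
  have g3: "G x y z w = G w y z x" for x y z w by (simp add: G_def mixed_skew commute(1)[of x])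
  have g4: "G x y z w = G x y w z" for x y z w
    using g1 g2 g3 by metis
  have "\<omega> (B y (A x z)) w = \<omega> (- A x (B y z)) w" for w
    using mixed_skew[of x y w z] g4[of x y w z] by (simp add: G_def \<omega>.minus_left)
  then have "\<omega> (B y (A x z) - - A x (B y z)) w = 0" for w
    unfolding \<omega>.diff_left by simp
  then have "B y (A x z) - - A x (B y z) = 0" by (rule nondegenerate)
  then show ?thesis by (simp only: right_minus_eq)
qed

text \<open>By \<open>square_zero\<close> the components of \<open>[u, [v, w]]\<close> contain only products of one \<open>A\<close> and one \<open>B\<close>;
  conversely \<open>[(0, x), [(0, z), (y, 0)]]\<close> isolates one such product.\<close>

lemma two_step_iff: "at_most_two_step_nilpotent (n_bracket A B) \<longleftrightarrow> (\<forall>x y z. A x (B y z) = 0)"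
proof
  assume *: "at_most_two_step_nilpotent (n_bracket A B)"
  show "\<forall>x y z. A x (B y z) = 0"
  proof (intro allI)
    fix x y z
    let ?S = "bracket_span (n_bracket A B) UNIV UNIV"
    have "n_bracket A B (0, z) (y, 0) \<in> ?S"
      unfolding bracket_span_def by (rule span_base) blast
    then have "n_bracket A B (0, x) (n_bracket A B (0, z) (y, 0)) \<in> bracket_span (n_bracket A B) UNIV ?S"
      unfolding bracket_span_def[of _ UNIV ?S] by (intro span_base) blast
    then have "n_bracket A B (0, x) (n_bracket A B (0, z) (y, 0)) = 0"
      using * unfolding at_most_two_step_nilpotent_def by blast
    then have "A (B y z) x = 0"
      by (simp add: n_bracket_def A.zero_left A.zero_right B.zero_left B.zero_right zero_prod_def)
    then show "A x (B y z) = 0" by (simp add: commute)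
  qed
next
  assume AB: "\<forall>x y z. A x (B y z) = 0"
  have BA: "B x (A y z) = 0" for x y z using AB by (simp add: anticommute)
  have inner: "n_bracket A B u (n_bracket A B v w) = 0" for u v w
    by (cases u; cases v; cases w)
      (simp add: n_bracket_def A.diff_right B.diff_right square_zero AB BA zero_prod_def
        commute(1)[of "B _ _ - B _ _"] commute(2)[of "B _ _ - B _ _"])
  have lin: "linear (n_bracket A B u)" for u
    by (cases u; rule linearI)
      (auto simp: n_bracket_def A.add_left A.add_right B.add_left B.add_right
        A.scaleR_left A.scaleR_right B.scaleR_left B.scaleR_right scaleR_diff_right)
  have "n_bracket A B u d = 0" if "d \<in> bracket_span (n_bracket A B) UNIV UNIV" for u d
    using that unfolding bracket_span_def
    by (rule linear_eq_0_on_span[OF lin, rotated]) (auto simp: inner)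
  then have "bracket_span (n_bracket A B) UNIV (bracket_span (n_bracket A B) UNIV UNIV)
      \<subseteq> span {0}"
    unfolding bracket_span_def[of _ _ "bracket_span _ _ _"] by (intro span_mono) auto
  then show "at_most_two_step_nilpotent (n_bracket A B)"
    unfolding at_most_two_step_nilpotent_def bracket_span_def[of _ _ "bracket_span _ _ _"]
    using span_zero by auto
qed

end

section \<open>The hypersymplectic metric of a double product\<close>

context compatible_pair
begin

text \<open>The differential at the neutral element of left translation by \<open>p\<close>, its inverse, and the
  derivative of the inverse in direction \<open>a\<close>.\<close>

definition translation_diff :: "(real^'m) \<times> (real^'m) \<Rightarrow> (real^'m) \<times> (real^'m) \<Rightarrow> (real^'m) \<times> (real^'m)"
  where "translation_diff p v =
    (fst v + B (snd p) (fst v),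
     snd v - A (snd p) (fst v) - (1/2) *\<^sub>R A (snd p) (B (snd p) (fst v)))"

definition coframe :: "(real^'m) \<times> (real^'m) \<Rightarrow> (real^'m) \<times> (real^'m) \<Rightarrow> (real^'m) \<times> (real^'m)"
  where "coframe p v =
    (fst v - B (snd p) (fst v),
     snd v + A (snd p) (fst v) - (1/2) *\<^sub>R A (snd p) (B (snd p) (fst v)))"

definition coframe_diff ::
    "(real^'m) \<times> (real^'m) \<Rightarrow> (real^'m) \<times> (real^'m) \<Rightarrow> (real^'m) \<times> (real^'m) \<Rightarrow> (real^'m) \<times> (real^'m)"
  where "coframe_diff p a v =
    (- B (snd a) (fst v), A (snd a) (fst v) - A (snd a) (B (snd p) (fst v)))"

text \<open>The Levi-Civita product on the Lie algebra. The operator of \<open>(x, x')\<close> is \<open>A x + B x'\<close> acting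
  diagonally; being diagonal it commutes with the hypersymplectic structure.\<close>

definition lc_product :: "(real^'m) \<times> (real^'m) \<Rightarrow> (real^'m) \<times> (real^'m) \<Rightarrow> (real^'m) \<times> (real^'m)"
  where "lc_product u v =
    (A (fst u) (fst v) + B (snd u) (fst v), A (fst u) (snd v) + B (snd u) (snd v))"

lemmas bilinear_simps =
  A.add_left A.add_right B.add_left B.add_right A.diff_left A.diff_right B.diff_left B.diff_right
  A.minus_left A.minus_right B.minus_left B.minus_right A.scaleR_left A.scaleR_right
  B.scaleR_left B.scaleR_right A.zero_left A.zero_right B.zero_left B.zero_right

lemma mixed_assoc: "A (B x y) z = A x (B y z)" "B (A x y) z = - A x (B y z)"
  using mixed[of z x y] anticommute[of z x y] mixed_commute[of x z y]
  by (simp_all add: commute(1)[of "B x y" z] commute(2)[of "A x y" z])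

lemma translation_diff_coframe: "translation_diff p (coframe p v) = v"
  by (cases v) (simp add: translation_diff_def coframe_def bilinear_simps square_zero algebra_simps
      flip: scaleR_2)

lemma coframe_translation_diff: "coframe p (translation_diff p v) = v"
  by (cases v) (simp add: translation_diff_def coframe_def bilinear_simps square_zero algebra_simps
      flip: scaleR_2)

lemma has_derivative_N_mult:
  "(N_mult A B p has_derivative translation_diff p) (at (0, 0))"
proof -
  have "N_mult A B p = (\<lambda>y. (fst p + fst y + B (fst y) (snd p) - (1/2) *\<^sub>R B (fst y) (A (fst y) (snd p)),
      snd p - A (snd p) (fst y) - (1/2) *\<^sub>R A (snd p) (B (snd p) (fst y)) + snd y))"
    by (cases p) (auto simp: N_mult_def fun_eq_iff)
  \<comment> \<open>The term \<open>B y (A y x')\<close> is quadratic in \<open>y\<close> and contributes nothing at the origin.\<close>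
  moreover have "(\<dots> has_derivative translation_diff p) (at (0, 0))"
    by (rule has_derivative_eq_rhs, (rule has_derivative_Pair has_derivative_add has_derivative_diff
          has_derivative_scaleR_right has_derivative_const has_derivative_fst has_derivative_snd
          has_derivative_ident A.FDERIV B.FDERIV)+)
      (simp add: translation_diff_def[abs_def] bilinear_simps commute(2)[of "snd p"] fun_eq_iff)
  ultimately show ?thesis by simp
qed

lemma left_translation_inverse: "inv (frechet_derivative (N_mult A B p) (at (0, 0))) = coframe p"
  using frechet_derivative_at[OF has_derivative_N_mult, of p]
  by (metis inv_equality translation_diff_coframe coframe_translation_diff)

lemma hypersymplectic_metric_eq:
  "hypersymplectic_metric \<omega> A B = (\<lambda>p u v. n_metric \<omega> (coframe p u) (coframe p v))"
  by (intro ext) (simp add: hypersymplectic_metric_def left_invariant_metric_def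
      left_translation_inverse)

lemma deriv_along_coframe:
  assumes "smooth Y"
  shows "deriv_along X (\<lambda>q. coframe q (Y q)) p
    = coframe p (deriv_along X Y p) + coframe_diff p (X p) (Y p)"
proof -
  let ?Y' = "frechet_derivative Y (at p)"
  have Y: "(Y has_derivative ?Y') (at p)" by (rule smooth_imp_has_derivative[OF assms])
  have "((\<lambda>q. coframe q (Y q)) has_derivative
      (\<lambda>a. coframe p (?Y' a) + coframe_diff p a (Y p))) (at p)"
    unfolding coframe_def
  proof (rule has_derivative_eq_rhs, (rule has_derivative_Pair has_derivative_add has_derivative_diff
          has_derivative_scaleR_right has_derivative_const has_derivative_fst has_derivative_snd
          has_derivative_ident A.FDERIV B.FDERIV Y)+, rule ext, goal_cases)
    case (1 a)
    show ?case
      using mixed[of "snd p" "snd a" "fst (Y p)"]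
      by (simp add: coframe_diff_def bilinear_simps algebra_simps)
  qed
  then show ?thesis using deriv_along_eqI by (simp add: deriv_along_def)
qed

lemma bilinear_lc_product: "bilinear lc_product"
  unfolding bilinear_def lc_product_def
  by (auto intro!: linearI simp: bilinear_simps algebra_simps)

lemma bilinear_n_metric: "bilinear (n_metric \<omega>)"
  unfolding bilinear_def n_metric_def
  by (auto intro!: linearI simp: \<omega>.add_left \<omega>.add_right \<omega>.scaleR_left \<omega>.scaleR_right algebra_simps)

sublocale moving_frame coframe translation_diff coframe_diff "n_bracket A B" lc_product "n_metric \<omega>"
proof (rule moving_frame.intro)
  fix p u v w a b :: "(real^'m) \<times> (real^'m)" and X Y :: "(real^'m) \<times> (real^'m) \<Rightarrow> (real^'m) \<times> (real^'m)"
  show "linear (coframe p)" "linear (translation_diff p)"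
    unfolding coframe_def translation_diff_def
    by (auto intro!: linearI simp: bilinear_simps algebra_simps)
  show "coframe p (translation_diff p v) = v" "translation_diff p (coframe p v) = v"
    by (rule coframe_translation_diff translation_diff_coframe)+
  show "smooth (\<lambda>p. coframe p (Y p))" "smooth (\<lambda>p. translation_diff p (Y p))" if "smooth Y"
    unfolding coframe_def translation_diff_def
    by (intro smooth_Pair smooth_diff smooth_add smooth_scaleR smooth_const
        smooth_bounded_bilinear[OF A.bounded_bilinear_axioms]
        smooth_bounded_bilinear[OF B.bounded_bilinear_axioms]
        smooth_bounded_linear_compose[OF bounded_linear_fst]
        smooth_bounded_linear_compose[OF bounded_linear_snd] smooth_ident that)+
  show "deriv_along X (\<lambda>q. coframe q (Y q)) p
      = coframe p (deriv_along X Y p) + coframe_diff p (X p) (Y p)" if "smooth Y"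
    by (rule deriv_along_coframe[OF that])
  show "bounded_bilinear lc_product" "bounded_bilinear (n_metric \<omega>)"
    by (intro bounded_bilinear_if_bilinear bilinear_lc_product bilinear_n_metric)+
  show "n_metric \<omega> u v = n_metric \<omega> v u"
    using skew[of "fst u" "snd v"] skew[of "snd u" "fst v"] by (simp add: n_metric_def split_beta)
  show "u = 0" if "\<And>v. n_metric \<omega> u v = 0"
  proof -
    have "\<omega> (fst u) z = 0" "\<omega> (snd u) z = 0" for z
      using that[of "(0, z)"] that[of "(z, 0)"]
      by (simp_all add: n_metric_def split_beta \<omega>.zero_right)
    then show ?thesis using nondegenerate by (simp add: prod_eq_iff)
  qed
  show "n_metric \<omega> (lc_product u v) w + n_metric \<omega> v (lc_product u w) = 0"
  proof -
    have "\<omega> (A x y) z = - \<omega> y (A x z)" "\<omega> (B x y) z = - \<omega> y (B x z)" for x y z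
      using compat[of x y z] skew[of y "A x z"] skew[of y "B x z"] by simp_all
    then show ?thesis
      by (simp add: n_metric_def lc_product_def split_beta \<omega>.add_left \<omega>.add_right)
  qed
  show "lc_product u v - lc_product v u = n_bracket A B u v"
    using commute(1)[of "fst u" "fst v"] commute(2)[of "snd u" "snd v"]
    by (simp add: lc_product_def n_bracket_def split_beta
        commute(2)[of "snd u" "fst v"] commute(2)[of "snd v" "fst u"])
  show "coframe_diff p b a - coframe_diff p a b = n_bracket A B (coframe p a) (coframe p b)"
    using mixed[of "snd p" "snd b" "fst a"] mixed[of "snd p" "snd a" "fst b"]
    by (simp add: coframe_diff_def n_bracket_def coframe_def split_beta bilinear_simps
        square_zero square_zero_left mixed_assoc anticommute commute(2)[of "fst b" "fst a"]
        commute(2)[of "fst b" "snd a"] commute(2)[of "fst a" "snd b"]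
        commute(1)[of "fst b" "snd a"] commute(1)[of "fst a" "snd b"]
        mixed[of "fst a"] mixed[of "fst b"] algebra_simps)
qed

lemma lc_product_curvature:
  "lc_product u (lc_product v w) - lc_product v (lc_product u w) - lc_product (n_bracket A B u v) w
   = (4 *\<^sub>R (A (fst u) (B (snd v) (fst w)) - A (fst v) (B (snd u) (fst w))),
      4 *\<^sub>R (A (fst u) (B (snd v) (snd w)) - A (fst v) (B (snd u) (snd w))))"
proof -
  \<comment> \<open>For \<open>u = (x, x')\<close> and \<open>v = (y, y')\<close>, each of \<open>A x \<circ> B y'\<close> and \<open>A y \<circ> B x'\<close> arises
    twice from the commutator and twice from the bracket.\<close>
  have four: "4 *\<^sub>R t = (t + t) + (t + t)" for t :: "real^'m"
    using scaleR_add_left[of 2 2 t] by (simp add: scaleR_2)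
  show ?thesis
    by (simp add: four lc_product_def n_bracket_def split_beta bilinear_simps square_zero
        mixed_assoc anticommute algebra_simps)
qed

lemma flat_iff: "flat_metric (hypersymplectic_metric \<omega> A B) \<longleftrightarrow> (\<forall>x y z. A x (B y z) = 0)"
proof -
  have "flat_metric (hypersymplectic_metric \<omega> A B) \<longleftrightarrow> (\<forall>u v w.
      lc_product u (lc_product v w) - lc_product v (lc_product u w)
        - lc_product (n_bracket A B u v) w = 0)"
    unfolding hypersymplectic_metric_eq by (rule flat_metric_iff)
  also have "\<dots> \<longleftrightarrow> (\<forall>x y z. A x (B y z) = 0)"
    unfolding lc_product_curvature
  proof (intro iffI allI)
    fix x y z
    assume "\<forall>u v w.
      (4 *\<^sub>R (A (fst u) (B (snd v) (fst w)) - A (fst v) (B (snd u) (fst w))),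
       4 *\<^sub>R (A (fst u) (B (snd v) (snd w)) - A (fst v) (B (snd u) (snd w)))) = 0"
    from this[rule_format, of "(x, 0)" "(0, y)" "(z, 0)"] show "A x (B y z) = 0"
      by (simp add: bilinear_simps zero_prod_def)
  qed (simp add: zero_prod_def)
  finally show ?thesis .
qed

end

theorem theorem4p2:
  fixes n :: nat
    and \<omega> :: "real^'m \<Rightarrow> real^'m \<Rightarrow> real"
    and A B :: "real^'m \<Rightarrow> real^'m \<Rightarrow> real^'m"
  assumes "CARD('m) = 2 * n"
    and "nondegenerate_skew_form \<omega>"
    and "affine_structure A" and "affine_structure B"
    and "compatible_with \<omega> A" and "compatible_with \<omega> B"
    and "\<forall>x y. A x \<circ> B y = A y \<circ> B x"
  shows "(at_most_two_step_nilpotent (n_bracket A B) \<longleftrightarrow> (\<forall>x y. A x \<circ> B y = (\<lambda>_. 0))) \<and>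
         ((\<forall>x y. A x \<circ> B y = (\<lambda>_. 0)) \<longleftrightarrow> flat_metric (hypersymplectic_metric \<omega> A B))"
proof -
  interpret compatible_pair \<omega> A B
    using assms by unfold_locales (auto simp: fun_eq_iff)
  have "(\<forall>x y. A x \<circ> B y = (\<lambda>_. 0)) \<longleftrightarrow> (\<forall>x y z. A x (B y z) = 0)"
    by (simp add: fun_eq_iff)
  then show ?thesis using two_step_iff flat_iff by simp
qed

end
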